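(* Let $n\ge2$ and let $G_n$ be the $n$-gonal poset. Then $G_n$ is retractable to the 2-chain $C_2$ by an $(n-1)$-fence-reflection, followed by a retraction of the singleton-symmetry if $n$ is even: for an $(n-1)$-fence $F$, $G_n\oslash F\cong C_2$ if $n$ is odd, and $(G_n\oslash F)\oslash C_1\cong C_2$ if $n$ is even, where $C_1$ is the one-element poset.
   Context: $C_2=\{x<y\}$ is the 2-chain and $C_1$ the singleton poset. An $m$-fence is a poset of elements $a_1,\dots,a_m$ with order generated by alternating relations $a_1<a_2>a_3<\cdots a_m$ (lower) or $a_1>a_2<a_3>\cdots a_m$ (upper). The $n$-gonal poset $G_n$ ($n\ge2$) is the $2n$-fence $a_1<a_2>a_3<\cdots<a_{2n}$ with the additional relation $a_{2n}>a_1$, making it cyclic (two layers: $a_{odd}$ minimal, $a_{even}$ maximal); it is the vertex–edge incidence poset of a regular $n$-gon. Notation: $\ell(X)$ is the cardinality of a longest chain. A subset $A$ of a poset $X$ is maximally ordered in $X$ if $|\{(a,b)\in A\times A:a<b\}|$ is maximal among subsets of $X$ of cardinality $|A|$. For $\sigma\in\mathrm{Aut}(P)$, $\Sigma(\sigma)=\{a:\sigma(a)\ne a\}$. For finite $Q$ and $r\ge2$: $\sigma$ is a $(Q,r)$-generator if there exist subsets $S_0,\dots,S_{r-1}\subset\Sigma(\sigma)$, each isomorphic to $Q$, which are smallest maximally ordered subsets of $\Sigma(\sigma)$ with $\sigma(S_i)=S_{(i+1)\bmod r}$, $\ell(S_i)=\ell(\Sigma(\sigma))$, $\bigcup_iS_i=\Sigma(\sigma)$;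 distinct $S_i,S_j$ are $(Q,r)$-symmetric subsets. Elements $a,b$ are $(Q,r,0)$-symmetric if $a=b$; $(Q,r,1)$-symmetric if there are $(Q,r)$-symmetric subsets $A,B$ with generator $\sigma$, $a\in A$, $b=\sigma^q(a)\in B$, $1\le q<r$; for $n\ge2$, $(Q,r,n)$-symmetric if not $(Q,r,j)$-symmetric for $j<n$ but there exist $c$, $j<n$ with $a$ $(Q,r,j)$-symmetric to $c$ and $c$ $(Q,r,n-j)$-symmetric to $b$; $(Q,r)$-symmetric if $(Q,r,n)$-symmetric for some $n\ge0$ (an equivalence relation). $P\oslash_rQ$ is the quotient poset of equivalence classes with $E\le F$ iff some $e\in E$, $f\in F$ satisfy $e\le f$; $P\oslash Q:=P\oslash_2Q$. Retractable to $\tilde P$ means obtained by such a sequence of quotients, with the result not isomorphic to $P$. *)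

theory Defs
  imports Main
begin

type_synonym 'a pos = "'a set \<times> ('a \<Rightarrow> 'a \<Rightarrow> bool)"

definition pcar :: "'a pos \<Rightarrow> 'a set" where "pcar P = fst P"
definition ple :: "'a pos \<Rightarrow> 'a \<Rightarrow> 'a \<Rightarrow> bool" where "ple P = snd P"

definition piso :: "'a pos \<Rightarrow> 'b pos \<Rightarrow> bool" where
  "piso P Q \<longleftrightarrow> (\<exists>f. bij_betw f (pcar P) (pcar Q) \<and>
     (\<forall>x\<in>pcar P. \<forall>y\<in>pcar P. ple P x y \<longleftrightarrow> ple Q (f x) (f y)))"

definition psub :: "'a pos \<Rightarrow> 'a set \<Rightarrow> 'a pos" where
  "psub P S = (S, ple P)"

definition C2 :: "nat pos" where "C2 = ({0, 1}, (\<le>))"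
definition C1 :: "nat pos" where "C1 = ({0}, (\<le>))"

text \<open>m-fences (lower or upper); positions 0..m-1 correspond to a_1..a_m.
  In a lower fence a_1 < a_2 > a_3 < ..., so position i is minimal iff i is even;
  in an upper fence position i is minimal iff i is odd.  The order generated by
  the alternating covering relations is: equality, or adjacency with the minimal
  position below.\<close>
definition fence_rel :: "bool \<Rightarrow> nat \<Rightarrow> nat \<Rightarrow> bool" where
  "fence_rel lower i j \<longleftrightarrow> i = j \<or>
     ((j = i + 1 \<or> i = j + 1) \<and> (if lower then even i else odd i))"

definition is_fence :: "nat \<Rightarrow> 'a pos \<Rightarrow> bool" where
  "is_fence m F \<longleftrightarrow> (\<exists>lower f. bij_betw f {0..<m} (pcar F) \<and>
     (\<forall>i<m. \<forall>j<m. ple F (f i) (f j) \<longleftrightarrow> fence_rel lower i j))"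

text \<open>The n-gonal poset G_n on {0..<2n}: index k stands for a_(k+1);
  even indices are minimal, odd indices maximal, and a_(2k+1) < a_(2k+2) > a_(2k+3),
  cyclically (a_(2n) > a_1).\<close>
definition Gpos :: "nat \<Rightarrow> nat pos" where
  "Gpos n = ({0..<2*n}, (\<lambda>i j. i = j \<or>
      (even i \<and> odd j \<and> (j = i + 1 \<or> i = (j + 1) mod (2*n)))))"

definition is_chain :: "'a pos \<Rightarrow> 'a set \<Rightarrow> bool" where
  "is_chain P C \<longleftrightarrow> C \<subseteq> pcar P \<and> (\<forall>x\<in>C. \<forall>y\<in>C. ple P x y \<or> ple P y x)"

definition ell :: "'a pos \<Rightarrow> nat" where
  "ell P = Max {card C | C. is_chain P C \<and> finite C}"

definition nlt :: "'a pos \<Rightarrow> 'a set \<Rightarrow> nat" where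
  "nlt P S = card {(a, b). a \<in> S \<and> b \<in> S \<and> ple P a b \<and> a \<noteq> b}"

definition max_ordered :: "'a pos \<Rightarrow> 'a set \<Rightarrow> 'a set \<Rightarrow> bool" where
  "max_ordered P X S \<longleftrightarrow> S \<subseteq> X \<and>
     (\<forall>T. T \<subseteq> X \<and> card T = card S \<longrightarrow> nlt P T \<le> nlt P S)"

definition is_aut :: "'a pos \<Rightarrow> ('a \<Rightarrow> 'a) \<Rightarrow> bool" where
  "is_aut P \<sigma> \<longleftrightarrow> bij_betw \<sigma> (pcar P) (pcar P) \<and>
     (\<forall>x\<in>pcar P. \<forall>y\<in>pcar P. ple P x y \<longleftrightarrow> ple P (\<sigma> x) (\<sigma> y))"

definition Sig :: "'a pos \<Rightarrow> ('a \<Rightarrow> 'a) \<Rightarrow> 'a set" where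
  "Sig P \<sigma> = {a \<in> pcar P. \<sigma> a \<noteq> a}"

definition sym_family :: "'a pos \<Rightarrow> nat \<Rightarrow> ('a \<Rightarrow> 'a) \<Rightarrow> (nat \<Rightarrow> 'a set) \<Rightarrow> nat \<Rightarrow> bool" where
  "sym_family P r \<sigma> S k \<longleftrightarrow>
     (\<forall>i<r. S i \<subseteq> Sig P \<sigma> \<and> card (S i) = k \<and> max_ordered P (Sig P \<sigma>) (S i) \<and>
            \<sigma> ` S i = S ((i + 1) mod r) \<and> ell (psub P (S i)) = ell (psub P (Sig P \<sigma>))) \<and>
     (\<Union>i<r. S i) = Sig P \<sigma>"

definition generator :: "'a pos \<Rightarrow> 'b pos \<Rightarrow> nat \<Rightarrow> ('a \<Rightarrow> 'a) \<Rightarrow> (nat \<Rightarrow> 'a set) \<Rightarrow> bool" where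
  "generator P Q r \<sigma> S \<longleftrightarrow> is_aut P \<sigma> \<and> 2 \<le> r \<and>
     sym_family P r \<sigma> S (card (pcar Q)) \<and>
     (\<forall>i<r. piso (psub P (S i)) Q) \<and>
     \<not> (\<exists>S' k. k < card (pcar Q) \<and> sym_family P r \<sigma> S' k)"

definition sym1 :: "'a pos \<Rightarrow> 'b pos \<Rightarrow> nat \<Rightarrow> 'a \<Rightarrow> 'a \<Rightarrow> bool" where
  "sym1 P Q r a b \<longleftrightarrow> (\<exists>\<sigma> S i j q. generator P Q r \<sigma> S \<and> i < r \<and> j < r \<and> S i \<noteq> S j \<and>
      a \<in> S i \<and> 1 \<le> q \<and> q < r \<and> b = (\<sigma> ^^ q) a \<and> b \<in> S j)"

text \<open>(Q,r)-symmetry: (Q,r,n)-symmetric for some n, i.e. the reflexive-transitive closure.\<close>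
definition symrel :: "'a pos \<Rightarrow> 'b pos \<Rightarrow> nat \<Rightarrow> 'a \<Rightarrow> 'a \<Rightarrow> bool" where
  "symrel P Q r = (sym1 P Q r)\<^sup>*\<^sup>*"

definition oquot_r :: "'a pos \<Rightarrow> 'b pos \<Rightarrow> nat \<Rightarrow> 'a set pos" where
  "oquot_r P Q r = ({{b \<in> pcar P. symrel P Q r a b} | a. a \<in> pcar P},
                    (\<lambda>E F. \<exists>e\<in>E. \<exists>f\<in>F. ple P e f))"

definition oquot :: "'a pos \<Rightarrow> 'b pos \<Rightarrow> 'a set pos" where
  "oquot P Q = oquot_r P Q 2"

end

theory Submission
  imports Defs
begin

text \<open>The reflection of the \<open>2n\<close>-cycle that fixes \<open>v\<close> and its antipode exchanges two disjoint,
  mutually incomparable \<open>(n-1)\<close>-fences. They are maximally ordered because \<open>n-1\<close> elements of a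
  union of paths span at most \<open>n-2\<close> edges, and smallest because together they have to cover
  \<open>2n-2\<close> moved elements. The reflection identifies \<open>v+1\<close> with \<open>v-1\<close>. The parity of \<open>v\<close> decides
  whether the fences are lower or upper. For odd \<open>n\<close> these are isomorphic, so both parities of \<open>v\<close>
  are available and both layers collapse. For even \<open>n\<close> one layer collapses; whatever the classes of
  the other layer are, the quotient is complete bipartite, so the transpositions within a layer are
  automorphisms and finish the collapse. The layers themselves are never merged, because
  automorphisms preserve the set of elements that have something strictly above them.\<close>

section \<open>Pairs of incomparable subsets exchanged by an automorphism\<close>

lemma piso_psub_image:
  assumes "is_aut P \<sigma>" "A \<subseteq> pcar P" "piso (psub P A) Q"
  shows "piso (psub P (\<sigma> ` A)) Q"
proof -
  from assms(3) obtain f where f: "bij_betw f A (pcar Q)"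
    "\<And>x y. x \<in> A \<Longrightarrow> y \<in> A \<Longrightarrow> ple P x y \<longleftrightarrow> ple Q (f x) (f y)"
    unfolding piso_def by (auto simp: psub_def pcar_def ple_def)
  have inj: "inj_on \<sigma> A"
    using assms(1,2) unfolding is_aut_def bij_betw_def by (meson inj_on_subset)
  define h where "h = f \<circ> the_inv_into A \<sigma>"
  have h: "h (\<sigma> x) = f x" if "x \<in> A" for x
    unfolding h_def using the_inv_into_f_f[OF inj that] by simp
  have "bij_betw h (\<sigma> ` A) (pcar Q)"
    unfolding h_def
    by (rule bij_betw_trans[OF _ f(1)]) (use inj in \<open>simp add: bij_betw_the_inv_into inj_on_imp_bij_betw\<close>)
  moreover have "ple P x y \<longleftrightarrow> ple Q (h x) (h y)" if "x \<in> \<sigma> ` A" "y \<in> \<sigma> ` A" for x y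
  proof -
    from that obtain a b where "a \<in> A" "b \<in> A" "x = \<sigma> a" "y = \<sigma> b" by blast
    moreover from this assms(1,2) have "ple P a b \<longleftrightarrow> ple P (\<sigma> a) (\<sigma> b)"
      unfolding is_aut_def by blast
    ultimately show ?thesis using f(2) h by simp
  qed
  ultimately show ?thesis
    unfolding piso_def psub_def by (intro exI[of _ h]) (simp add: pcar_def ple_def)
qed

lemma nlt_image:
  assumes "is_aut P \<sigma>" "A \<subseteq> pcar P"
  shows "nlt P (\<sigma> ` A) = nlt P A"
proof -
  have inj: "inj_on \<sigma> A"
    using assms unfolding is_aut_def bij_betw_def by (meson inj_on_subset)
  let ?R = "\<lambda>S. {(a, b). a \<in> S \<and> b \<in> S \<and> ple P a b \<and> a \<noteq> b}"
  have le: "ple P x y \<longleftrightarrow> ple P (\<sigma> x) (\<sigma> y)" if "x \<in> A" "y \<in> A" for x y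
    using assms that unfolding is_aut_def by blast
  have "?R (\<sigma> ` A) = map_prod \<sigma> \<sigma> ` ?R A"
  proof (intro equalityI subsetI)
    fix p assume "p \<in> ?R (\<sigma> ` A)"
    then obtain x y where "p = (\<sigma> x, \<sigma> y)" "x \<in> A" "y \<in> A" "ple P (\<sigma> x) (\<sigma> y)" "\<sigma> x \<noteq> \<sigma> y"
      by auto
    then show "p \<in> map_prod \<sigma> \<sigma> ` ?R A"
      using le by (intro image_eqI[of _ _ "(x, y)"]) auto
  next
    fix p assume "p \<in> map_prod \<sigma> \<sigma> ` ?R A"
    then obtain x y where "p = (\<sigma> x, \<sigma> y)" "x \<in> A" "y \<in> A" "ple P x y" "x \<noteq> y"
      by auto
    then show "p \<in> ?R (\<sigma> ` A)"
      using le inj_on_eq_iff[OF inj] by simp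
  qed
  moreover have "inj_on (map_prod \<sigma> \<sigma>) (?R A)"
    using inj by (auto simp: inj_on_def)
  ultimately show ?thesis
    unfolding nlt_def by (simp add: card_image)
qed

text \<open>Incomparability forces every chain of the union into \<open>A\<close> or into
  \<open>B\<close>, and \<open>\<sigma>\<close> carries chains in \<open>B\<close> to chains of the
  same size in \<open>A\<close>. Hence the sets of chain sizes themselves agree, and with them their
  maxima.\<close>

lemma ell_psub_union_image:
  assumes aut: "is_aut P \<sigma>" and sub: "A \<subseteq> pcar P" "B \<subseteq> pcar P"
    and swap: "\<sigma> ` A = B" "\<sigma> ` B = A"
    and inc: "\<And>a b. a \<in> A \<Longrightarrow> b \<in> B \<Longrightarrow> \<not> ple P a b \<and> \<not> ple P b a"
  shows "ell (psub P A) = ell (psub P (A \<union> B))"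
proof -
  have chain: "is_chain (psub P S) C \<longleftrightarrow> C \<subseteq> S \<and> (\<forall>x\<in>C. \<forall>y\<in>C. ple P x y \<or> ple P y x)" for S C
    by (simp add: is_chain_def psub_def pcar_def ple_def)
  have "\<exists>D. card C = card D \<and> is_chain (psub P A) D \<and> finite D"
    if C: "is_chain (psub P (A \<union> B)) C" "finite C" for C
  proof (cases "C \<subseteq> A")
    case True
    with C have "is_chain (psub P A) C" unfolding chain by simp
    with C(2) show ?thesis by blast
  next
    case False
    then obtain c where c: "c \<in> C" "c \<notin> A" by blast
    have CB: "C \<subseteq> B"
    proof
      fix x assume "x \<in> C"
      then have "x \<in> A \<union> B" "c \<in> B" "ple P x c \<or> ple P c x"
        using C(1) c unfolding chain by blast+
      then show "x \<in> B" using inc by blast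
    qed
    have "inj_on \<sigma> C"
      using aut CB sub(2) unfolding is_aut_def bij_betw_def by (meson inj_on_subset subset_trans)
    then have "card C = card (\<sigma> ` C)" by (simp add: card_image)
    moreover have "is_chain (psub P A) (\<sigma> ` C)"
      unfolding chain ball_simps
    proof (intro conjI ballI)
      show "\<sigma> ` C \<subseteq> A" using CB swap(2) by blast
    next
      fix x y assume "x \<in> C" "y \<in> C"
      moreover from this have "x \<in> pcar P" "y \<in> pcar P" using CB sub(2) by blast+
      moreover from this aut have "ple P x y \<longleftrightarrow> ple P (\<sigma> x) (\<sigma> y)" "ple P y x \<longleftrightarrow> ple P (\<sigma> y) (\<sigma> x)"
        unfolding is_aut_def by blast+
      ultimately show "ple P (\<sigma> x) (\<sigma> y) \<or> ple P (\<sigma> y) (\<sigma> x)"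
        using C(1) unfolding chain by blast
    qed
    ultimately show ?thesis using C(2) by (intro exI[of _ "\<sigma> ` C"]) simp
  qed
  moreover have "is_chain (psub P (A \<union> B)) C" if "is_chain (psub P A) C" for C
    using that unfolding chain by blast
  ultimately have "{card C | C. is_chain (psub P A) C \<and> finite C} =
      {card C | C. is_chain (psub P (A \<union> B)) C \<and> finite C}"
    by blast
  then show ?thesis unfolding ell_def by simp
qed

text \<open>Working form for two subsets: the cyclic shift becomes a swap, and the inclusion in
  \<open>Sig P \<sigma>\<close> is absorbed by \<open>max_ordered\<close>, which contains
  it.\<close>

lemma sym_family_two_iff:
  "sym_family P 2 \<sigma> S k \<longleftrightarrow>
     card (S 0) = k \<and> max_ordered P (Sig P \<sigma>) (S 0) \<and> \<sigma> ` S 0 = S 1 \<and>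
       ell (psub P (S 0)) = ell (psub P (Sig P \<sigma>)) \<and>
     card (S 1) = k \<and> max_ordered P (Sig P \<sigma>) (S 1) \<and> \<sigma> ` S 1 = S 0 \<and>
       ell (psub P (S 1)) = ell (psub P (Sig P \<sigma>)) \<and>
     S 0 \<union> S 1 = Sig P \<sigma>"
proof -
  have all: "(\<forall>i<2. R i) \<longleftrightarrow> R 0 \<and> R (1::nat)" for R
    by (auto simp: less_2_cases_iff)
  have un: "(\<Union>i<2. S i) = S 0 \<union> S 1"
    by (auto simp: less_2_cases_iff)
  have idx: "(0 + 1) mod 2 = (1::nat)" "(1 + 1) mod 2 = (0::nat)" by simp_all
  have sub: "X \<subseteq> Sig P \<sigma> \<and> c \<and> max_ordered P (Sig P \<sigma>) X \<and> d \<longleftrightarrow>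
      c \<and> max_ordered P (Sig P \<sigma>) X \<and> d" for X c d
    unfolding max_ordered_def by blast
  show ?thesis
    unfolding sym_family_def all un idx sub by (simp only: conj_assoc)
qed

text \<open>Common criterion for the polygon reflections and for transpositions. Pair counts and
  chain lengths transfer from \<open>A\<close> to \<open>B\<close> along the automorphism. No family
  with a smaller size \<open>k\<close> exists, since its two members would cover at most
  \<open>2 * k\<close> of the \<open>2 * card A\<close> moved elements.\<close>

lemma generator_reflection:
  assumes aut: "is_aut P \<sigma>" and Sig: "Sig P \<sigma> = A \<union> B"
    and swap: "\<sigma> ` A = B" "\<sigma> ` B = A" and disj: "A \<inter> B = {}" and fin: "finite A"
    and inc: "\<And>a b. a \<in> A \<Longrightarrow> b \<in> B \<Longrightarrow> \<not> ple P a b \<and> \<not> ple P b a"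
    and iso: "piso (psub P A) Q"
    and max: "\<And>T. T \<subseteq> Sig P \<sigma> \<Longrightarrow> card T = card A \<Longrightarrow> nlt P T \<le> nlt P A"
  shows "generator P Q 2 \<sigma> (\<lambda>i. if i = 0 then A else B)"
proof -
  have sub: "A \<subseteq> pcar P" "B \<subseteq> pcar P"
    using Sig unfolding Sig_def by blast+
  have cAQ: "card A = card (pcar Q)"
    using iso unfolding piso_def psub_def pcar_def by (auto dest: bij_betw_same_card)
  have inj: "inj_on \<sigma> A"
    using aut sub unfolding is_aut_def bij_betw_def by (meson inj_on_subset)
  then have cAB: "card B = card A" using swap(1) card_image by blast
  have finB: "finite B" using swap(1) fin by blast
  have nltB: "nlt P B = nlt P A" using nlt_image[OF aut sub(1)] swap(1) by simp
  have maxA: "max_ordered P (Sig P \<sigma>) A" unfolding max_ordered_def using max Sig by auto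
  have maxB: "max_ordered P (Sig P \<sigma>) B" unfolding max_ordered_def using max Sig cAB nltB by auto
  have ellA: "ell (psub P A) = ell (psub P (A \<union> B))"
    by (rule ell_psub_union_image[OF aut sub swap inc])
  have ellB: "ell (psub P B) = ell (psub P (A \<union> B))"
    using ell_psub_union_image[OF aut sub(2,1) swap(2,1)] inc by (simp add: Un_commute)
  have "sym_family P 2 \<sigma> (\<lambda>i. if i = 0 then A else B) (card (pcar Q))"
    unfolding sym_family_two_iff using Sig swap maxA maxB ellA ellB cAB cAQ by simp
  moreover have "\<not> sym_family P 2 \<sigma> S k" if k: "k < card (pcar Q)" for S k
  proof
    assume "sym_family P 2 \<sigma> S k"
    then have "card (S 0) = k" "card (S 1) = k" "S 0 \<union> S 1 = A \<union> B"
      unfolding sym_family_two_iff using Sig by simp_all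
    moreover have "card (A \<union> B) = 2 * card A"
      using fin finB disj cAB by (simp add: card_Un_disjoint)
    ultimately show False
      using card_Un_le[of "S 0" "S 1"] k cAQ by simp
  qed
  moreover have "piso (psub P B) Q" using piso_psub_image[OF aut sub(1) iso] swap(1) by simp
  ultimately show ?thesis
    unfolding generator_def using aut iso by (intro conjI notI) (blast | simp)+
qed

lemma sym1_reflection:
  assumes gen: "generator P Q 2 \<sigma> (\<lambda>i. if i = 0 then A else B)" and disj: "A \<inter> B = {}" and "a \<in> A"
  shows "sym1 P Q 2 a (\<sigma> a)"
proof -
  have "\<sigma> ` A = B" using gen unfolding generator_def sym_family_two_iff by simp
  \<comment> \<open>Index 0 carries \<open>A\<close>, index 1 carries \<open>B\<close>, and
    \<open>\<sigma>\<close> is applied once. The two subsets differ because \<open>a\<close> lies in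
    \<open>A\<close> only.\<close>
  then show ?thesis
    unfolding sym1_def using assms
    by (intro exI[of _ \<sigma>] exI[of _ "\<lambda>i. if i = 0 then A else B"] exI[of _ 0] exI[of _ "1::nat"]) auto
qed

section \<open>Inverse generators and the equivalence relation\<close>

lemma sym_family_inverse:
  assumes fam: "sym_family P 2 \<sigma> S k" and aut: "is_aut P \<sigma>" and aut': "is_aut P \<tau>"
    and inv: "\<And>x. x \<in> pcar P \<Longrightarrow> \<tau> (\<sigma> x) = x"
  shows "sym_family P 2 \<tau> S k"
proof -
  have "Sig P \<tau> = Sig P \<sigma>"
  proof -
    have "\<tau> x = x \<longleftrightarrow> \<sigma> x = x" if x: "x \<in> pcar P" for x
    proof
      assume *: "\<tau> x = x"
      from aut x have "\<sigma> x \<in> pcar P" unfolding is_aut_def bij_betw_def by blast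
      moreover have "\<tau> (\<sigma> x) = \<tau> x" using inv[OF x] * by simp
      ultimately show "\<sigma> x = x"
        using aut' x unfolding is_aut_def bij_betw_def by (meson inj_onD)
    next
      assume "\<sigma> x = x" then show "\<tau> x = x" using inv[OF x] by simp
    qed
    then show ?thesis unfolding Sig_def by auto
  qed
  \<comment> \<open>With two subsets the cyclic shift is a swap, and undoing a swap is the same
    swap, so the family keeps its indexing.\<close>
  moreover have "\<tau> ` S 0 = S 1" "\<tau> ` S 1 = S 0"
  proof -
    have S: "\<sigma> ` S 0 = S 1" "\<sigma> ` S 1 = S 0" "S 0 \<subseteq> pcar P" "S 1 \<subseteq> pcar P"
      using fam unfolding sym_family_two_iff Sig_def by blast+
    have "\<tau> ` (\<sigma> ` X) = X" if "X \<subseteq> pcar P" for X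
      using that inv by (force simp: image_image)
    then show "\<tau> ` S 0 = S 1" "\<tau> ` S 1 = S 0" using S by metis+
  qed
  ultimately show ?thesis
    using fam unfolding sym_family_two_iff by simp
qed

text \<open>A generator exchanges the two subsets but need not be an involution, so
  \<open>\<sigma> b\<close> may differ from \<open>a\<close>. The return link uses the inverse
  automorphism with the same family and exchanged indices.\<close>

lemma sym1_sym:
  assumes "sym1 P Q 2 a b"
  shows "sym1 P Q 2 b a"
proof -
  from assms obtain \<sigma> S i j q where gen: "generator P Q 2 \<sigma> S" and ij: "i < 2" "j < 2" "S i \<noteq> S j"
    and a: "a \<in> S i" "b \<in> S j" and q: "1 \<le> q" "q < 2" "b = (\<sigma> ^^ q) a"
    unfolding sym1_def by blast
  from q(1,2) have "q = 1" by simp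
  with q(3) have b: "b = \<sigma> a" by simp
  have aut: "is_aut P \<sigma>" using gen unfolding generator_def by blast
  have aP: "a \<in> pcar P"
    using gen ij a unfolding generator_def sym_family_def Sig_def by blast
  define \<tau> where "\<tau> = inv_into (pcar P) \<sigma>"
  have bij: "bij_betw \<sigma> (pcar P) (pcar P)" using aut unfolding is_aut_def by blast
  have inv: "\<tau> (\<sigma> x) = x" "\<sigma> (\<tau> x) = x" if "x \<in> pcar P" for x
    unfolding \<tau>_def using bij that by (simp_all add: bij_betw_inv_into_left bij_betw_inv_into_right)
  have bij': "bij_betw \<tau> (pcar P) (pcar P)" unfolding \<tau>_def using bij by (rule bij_betw_inv_into)
  have aut': "is_aut P \<tau>"
    unfolding is_aut_def
  proof (intro conjI ballI bij')
    fix x y assume xy: "x \<in> pcar P" "y \<in> pcar P"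
    then have "\<tau> x \<in> pcar P" "\<tau> y \<in> pcar P" using bij' unfolding bij_betw_def by blast+
    then have "ple P (\<tau> x) (\<tau> y) \<longleftrightarrow> ple P (\<sigma> (\<tau> x)) (\<sigma> (\<tau> y))"
      using aut unfolding is_aut_def by blast
    then show "ple P x y \<longleftrightarrow> ple P (\<tau> x) (\<tau> y)" using inv xy by simp
  qed
  \<comment> \<open>Minimality passes to \<open>\<tau>\<close> because a smaller family for
    \<open>\<tau>\<close> would also be one for its inverse \<open>\<sigma>\<close>.\<close>
  have "generator P Q 2 \<tau> S"
    using gen sym_family_inverse[OF _ aut aut' inv(1)] sym_family_inverse[OF _ aut' aut inv(2)] aut'
    unfolding generator_def by blast
  then show ?thesis
    unfolding sym1_def using ij a b inv(1)[OF aP]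
    by (intro exI[of _ \<tau>] exI[of _ S] exI[of _ j] exI[of _ i] exI[of _ "1::nat"]) auto
qed

lemma symrel_sym: "symrel P Q 2 a b \<Longrightarrow> symrel P Q 2 b a"
  unfolding symrel_def
proof (induction rule: rtranclp_induct)
  case (step b c)
  show ?case
    by (rule converse_rtranclp_into_rtranclp[OF sym1_sym[OF step.hyps(2)] step.IH])
qed simp

lemma symrel_trans: "symrel P Q r a b \<Longrightarrow> symrel P Q r b c \<Longrightarrow> symrel P Q r a c"
  unfolding symrel_def by simp

lemma symrel_refl: "symrel P Q r a a"
  unfolding symrel_def by simp

section \<open>Two-layer posets and their quotients\<close>

lemma ple_oquot: "ple (oquot P Q) E F \<longleftrightarrow> (\<exists>e\<in>E. \<exists>f\<in>F. ple P e f)"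
  unfolding oquot_def oquot_r_def ple_def by simp

text \<open>Posets of height two without isolated elements. The notion is inherited by quotients, so
  the polygon and its first quotient are handled by the same lemmas.\<close>

locale two_layer =
  fixes P :: "'a pos" and L U :: "'a set"
  assumes carrier: "pcar P = L \<union> U" and nonempty: "L \<noteq> {}" and disjoint: "L \<inter> U = {}"
    and refl: "x \<in> pcar P \<Longrightarrow> ple P x x"
    and strict: "x \<in> pcar P \<Longrightarrow> y \<in> pcar P \<Longrightarrow> ple P x y \<Longrightarrow> x \<noteq> y \<Longrightarrow> x \<in> L \<and> y \<in> U"
    and above: "x \<in> L \<Longrightarrow> \<exists>y\<in>U. ple P x y"
    and below: "y \<in> U \<Longrightarrow> \<exists>x\<in>L. ple P x y"
begin

lemma aut_closed: "is_aut P \<sigma> \<Longrightarrow> x \<in> pcar P \<Longrightarrow> \<sigma> x \<in> pcar P"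
  unfolding is_aut_def bij_betw_def by blast

text \<open>The order alone determines the lower layer, which is what makes it invariant under
  automorphisms; \<open>above\<close> supplies the larger element.\<close>

lemma lower_iff: "x \<in> L \<longleftrightarrow> x \<in> pcar P \<and> (\<exists>y\<in>pcar P. y \<noteq> x \<and> ple P x y)"
proof
  assume x: "x \<in> L"
  then obtain y where "y \<in> U" "ple P x y" using above by blast
  moreover from this x disjoint have "y \<noteq> x" by blast
  ultimately show "x \<in> pcar P \<and> (\<exists>y\<in>pcar P. y \<noteq> x \<and> ple P x y)"
    using x unfolding carrier by blast
next
  assume "x \<in> pcar P \<and> (\<exists>y\<in>pcar P. y \<noteq> x \<and> ple P x y)"
  then obtain y where "x \<in> pcar P" "y \<in> pcar P" "ple P x y" "x \<noteq> y" by blast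
  then show "x \<in> L" using strict by simp
qed

lemma aut_lower_iff:
  assumes aut: "is_aut P \<sigma>" and x: "x \<in> pcar P"
  shows "\<sigma> x \<in> L \<longleftrightarrow> x \<in> L"
proof -
  have img: "\<sigma> ` pcar P = pcar P" and inj: "inj_on \<sigma> (pcar P)"
    using aut unfolding is_aut_def bij_betw_def by blast+
  \<comment> \<open>Since \<open>\<sigma>\<close> permutes the carrier, the bound variable may run
    over images instead; the automorphism property then removes \<open>\<sigma>\<close>.\<close>
  have "(\<exists>y\<in>pcar P. y \<noteq> \<sigma> x \<and> ple P (\<sigma> x) y) \<longleftrightarrow>
      (\<exists>y\<in>pcar P. \<sigma> y \<noteq> \<sigma> x \<and> ple P (\<sigma> x) (\<sigma> y))"
    by (subst img[symmetric]) simp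
  also have "\<dots> \<longleftrightarrow> (\<exists>y\<in>pcar P. y \<noteq> x \<and> ple P x y)"
  proof (rule bex_cong[OF HOL.refl])
    fix y assume y: "y \<in> pcar P"
    show "\<sigma> y \<noteq> \<sigma> x \<and> ple P (\<sigma> x) (\<sigma> y) \<longleftrightarrow> y \<noteq> x \<and> ple P x y"
      using aut x y inj_on_eq_iff[OF inj y x] unfolding is_aut_def by simp
  qed
  finally show ?thesis
    using lower_iff[of x] lower_iff[of "\<sigma> x"] x aut_closed[OF aut x] by simp
qed

lemma sym1_layer:
  assumes "sym1 P Q r a b"
  shows "a \<in> pcar P \<and> b \<in> pcar P \<and> (b \<in> L \<longleftrightarrow> a \<in> L)"
proof -
  from assms obtain \<sigma> S i q where gen: "generator P Q r \<sigma> S" and "i < r" "a \<in> S i" "b = (\<sigma> ^^ q) a"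
    unfolding sym1_def by blast
  then have aut: "is_aut P \<sigma>" and a: "a \<in> pcar P"
    unfolding generator_def sym_family_def Sig_def by blast+
  have "(\<sigma> ^^ q) a \<in> pcar P \<and> ((\<sigma> ^^ q) a \<in> L \<longleftrightarrow> a \<in> L)"
    by (induction q) (use a aut_closed[OF aut] aut_lower_iff[OF aut] in auto)
  then show ?thesis using a \<open>b = _\<close> by simp
qed

lemma symrel_layer:
  assumes "symrel P Q r a b" "a \<in> pcar P"
  shows "b \<in> pcar P \<and> (b \<in> L \<longleftrightarrow> a \<in> L)"
  using assms unfolding symrel_def
  by (induction rule: rtranclp_induct) (use sym1_layer in blast)+

lemma symrel_upper: "symrel P Q r a b \<Longrightarrow> a \<in> U \<Longrightarrow> b \<in> U"
  using symrel_layer carrier disjoint by blast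

lemma symrel_lower: "symrel P Q r a b \<Longrightarrow> a \<in> L \<Longrightarrow> b \<in> L"
  using symrel_layer carrier by blast

text \<open>Links never leave a layer, so once each layer is linked throughout, the classes are
  exactly \<open>L\<close> and \<open>U\<close>.\<close>

lemma oquot_piso_C2:
  assumes l: "\<And>a b. a \<in> L \<Longrightarrow> b \<in> L \<Longrightarrow> symrel P Q 2 a b"
    and u: "\<And>a b. a \<in> U \<Longrightarrow> b \<in> U \<Longrightarrow> symrel P Q 2 a b"
  shows "piso (oquot P Q) C2"
proof -
  have cl: "{b \<in> pcar P. symrel P Q 2 a b} = L" if "a \<in> L" for a
    using that l symrel_lower carrier by blast
  have cu: "{b \<in> pcar P. symrel P Q 2 a b} = U" if "a \<in> U" for a
    using that u symrel_upper carrier by blast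
  have Une: "U \<noteq> {}" using nonempty above by blast
  have "{{b \<in> pcar P. symrel P Q 2 a b} | a. a \<in> pcar P} = (\<lambda>a. {b \<in> pcar P. symrel P Q 2 a b}) ` (L \<union> U)"
    unfolding carrier[symmetric] by blast
  also have "\<dots> = (\<lambda>a. L) ` L \<union> (\<lambda>a. U) ` U"
    unfolding image_Un using cl cu by (intro arg_cong2[of _ _ _ _ "(\<union>)"] image_cong) auto
  also have "\<dots> = {L, U}"
    using nonempty Une by auto
  finally have car: "pcar (oquot P Q) = {L, U}"
    unfolding oquot_def oquot_r_def pcar_def by simp
  have LU: "L \<noteq> U" using disjoint nonempty by blast
  have 1: "ple (oquot P Q) L L" unfolding ple_oquot using nonempty refl carrier by blast
  have 2: "ple (oquot P Q) U U" unfolding ple_oquot using Une refl carrier by blast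
  have 3: "ple (oquot P Q) L U" unfolding ple_oquot using nonempty above by blast
  have 4: "\<not> ple (oquot P Q) U L" unfolding ple_oquot using strict carrier disjoint by blast
  show ?thesis
    unfolding piso_def
  proof (intro exI[of _ "\<lambda>E. if E = L then 0 else 1 :: nat"] conjI)
    show "bij_betw (\<lambda>E. if E = L then 0 else 1 :: nat) (pcar (oquot P Q)) (pcar C2)"
      unfolding car using LU by (auto simp: bij_betw_def inj_on_def C2_def pcar_def)
    show "\<forall>x\<in>pcar (oquot P Q). \<forall>y\<in>pcar (oquot P Q). ple (oquot P Q) x y \<longleftrightarrow>
        ple C2 (if x = L then 0 else 1) (if y = L then 0 else 1)"
      unfolding car using LU 1 2 3 4 by (auto simp: C2_def ple_def)
  qed
qed

definition sym_class :: "'b pos \<Rightarrow> 'a \<Rightarrow> 'a set" where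
  "sym_class Q a = {b \<in> pcar P. symrel P Q 2 a b}"

lemma sym_class_eq: "symrel P Q 2 a b \<Longrightarrow> sym_class Q a = sym_class Q b"
  unfolding sym_class_def by (intro Collect_cong) (metis symrel_sym symrel_trans)

lemma in_sym_class: "a \<in> pcar P \<Longrightarrow> a \<in> sym_class Q a"
  unfolding sym_class_def by (simp add: symrel_refl)

text \<open>No class mixes the layers, so the images of \<open>L\<close> and \<open>U\<close> stay
  disjoint, and comparabilities of elements descend to their classes.\<close>

lemma two_layer_oquot: "two_layer (oquot P Q) (sym_class Q ` L) (sym_class Q ` U)"
proof
  show car: "pcar (oquot P Q) = sym_class Q ` L \<union> sym_class Q ` U"
    unfolding image_Un[symmetric] carrier[symmetric]
    by (auto simp: oquot_def oquot_r_def pcar_def sym_class_def)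
  show "sym_class Q ` L \<noteq> {}" using nonempty by blast
  have cu: "sym_class Q a \<subseteq> U" if "a \<in> U" for a
    unfolding sym_class_def using that symrel_upper by blast
  have "sym_class Q a \<noteq> sym_class Q b" if "a \<in> L" "b \<in> U" for a b
  proof -
    have "a \<in> sym_class Q a" using that carrier by (intro in_sym_class) simp
    moreover have "a \<notin> sym_class Q b" using that cu[of b] disjoint by blast
    ultimately show ?thesis by metis
  qed
  then show "sym_class Q ` L \<inter> sym_class Q ` U = {}" by blast
  have le: "ple (oquot P Q) (sym_class Q a) (sym_class Q b)"
    if "a \<in> pcar P" "b \<in> pcar P" "ple P a b" for a b
    unfolding ple_oquot using in_sym_class[OF that(1)] in_sym_class[OF that(2)] that(3) by blast
  show "ple (oquot P Q) E E" if "E \<in> pcar (oquot P Q)" for E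
  proof -
    from that obtain a where "a \<in> pcar P" "E = sym_class Q a" unfolding car carrier by blast
    then show ?thesis using le refl by simp
  qed
  show "\<exists>F\<in>sym_class Q ` U. ple (oquot P Q) E F" if "E \<in> sym_class Q ` L" for E
  proof -
    from that obtain a where a: "a \<in> L" "E = sym_class Q a" by blast
    with above obtain b where "b \<in> U" "ple P a b" by blast
    with a le[of a b] show ?thesis unfolding carrier by blast
  qed
  show "\<exists>E\<in>sym_class Q ` L. ple (oquot P Q) E F" if "F \<in> sym_class Q ` U" for F
  proof -
    from that obtain b where b: "b \<in> U" "F = sym_class Q b" by blast
    with below obtain a where "a \<in> L" "ple P a b" by blast
    with b le[of a b] show ?thesis unfolding carrier by blast
  qed
  show "E \<in> sym_class Q ` L \<and> F \<in> sym_class Q ` U"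
    if EF: "E \<in> pcar (oquot P Q)" "F \<in> pcar (oquot P Q)" "ple (oquot P Q) E F" "E \<noteq> F" for E F
  proof -
    from EF(1,2) obtain a b where ab: "a \<in> pcar P" "b \<in> pcar P" "E = sym_class Q a" "F = sym_class Q b"
      unfolding car carrier by blast
    from EF(3) obtain e f where ef: "e \<in> E" "f \<in> F" "ple P e f" unfolding ple_oquot by blast
    then have e: "e \<in> pcar P" "symrel P Q 2 a e" and f: "f \<in> pcar P" "symrel P Q 2 b f"
      unfolding ab sym_class_def by simp_all
    \<comment> \<open>The elements witnessing the comparability need not be the representatives
      chosen above. Naming both classes after these witnesses makes \<open>strict\<close> of
      \<open>P\<close> applicable.\<close>
    then have E: "E = sym_class Q e" and F: "F = sym_class Q f"
      unfolding ab by (simp_all only: sym_class_eq[OF e(2)] sym_class_eq[OF f(2)])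
    with EF(4) have "e \<noteq> f" by blast
    with strict[OF e(1) f(1) ef(3)] E F show ?thesis by blast
  qed
qed

text \<open>If all of \<open>L\<close> lies below all of \<open>U\<close>, the order depends on the
  layers alone. Exchanging two elements of one layer is then an automorphism whose moved elements
  are two incomparable singletons.\<close>

lemma oquot_C1_piso_C2:
  assumes full: "\<And>x y. x \<in> L \<Longrightarrow> y \<in> U \<Longrightarrow> ple P x y"
  shows "piso (oquot P C1) C2"
proof -
  have swap: "symrel P C1 2 a b"
    if ab: "a \<in> pcar P" "b \<in> pcar P" "a \<in> L \<longleftrightarrow> b \<in> L" for a b
  proof (cases "a = b")
    case True
    then show ?thesis by (simp add: symrel_refl)
  next
    case False
    define \<sigma> where "\<sigma> = id(a := b, b := a)"
    have le: "ple P x y \<longleftrightarrow> x = y \<or> x \<in> L \<and> y \<in> U" if "x \<in> pcar P" "y \<in> pcar P" for x y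
      using full[of x y] refl[of x] strict[of x y] that by blast
    have s: "\<sigma> x = (if x = b then a else if x = a then b else x)" for x
      unfolding \<sigma>_def by simp
    have closed: "\<sigma> x \<in> pcar P" if "x \<in> pcar P" for x using that ab(1,2) by (simp add: s)
    have invol: "\<sigma> (\<sigma> x) = x" for x by (simp add: s)
    have "bij_betw \<sigma> (pcar P) (pcar P)"
      by (rule bij_betw_byWitness[where f' = \<sigma>]) (use closed invol in auto)
    moreover have "ple P x y \<longleftrightarrow> ple P (\<sigma> x) (\<sigma> y)" if xy: "x \<in> pcar P" "y \<in> pcar P" for x y
    proof -
      have "a \<in> U \<longleftrightarrow> b \<in> U" using ab disjoint unfolding carrier by blast
      then have "\<sigma> x \<in> L \<longleftrightarrow> x \<in> L" "\<sigma> y \<in> U \<longleftrightarrow> y \<in> U" using ab(3) by (simp_all add: s)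
      moreover have "\<sigma> x = \<sigma> y \<longleftrightarrow> x = y" using invol by metis
      ultimately show ?thesis using le[OF xy] le[OF closed[OF xy(1)] closed[OF xy(2)]] by simp
    qed
    ultimately have aut: "is_aut P \<sigma>"
      unfolding is_aut_def by blast
    have "generator P C1 2 \<sigma> (\<lambda>i. if i = 0 then {a} else {b})"
    proof (rule generator_reflection[OF aut])
      show "Sig P \<sigma> = {a} \<union> {b}" unfolding Sig_def using ab(1,2) False by (auto simp: s)
      show "\<sigma> ` {a} = {b}" "\<sigma> ` {b} = {a}" using False by (simp_all add: s)
      show "{a} \<inter> {b} = {}" using False by simp
      show "\<not> ple P x y \<and> \<not> ple P y x" if "x \<in> {a}" "y \<in> {b}" for x y
        using that ab(3) le[OF ab(1,2)] le[OF ab(2,1)] False disjoint by blast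
      show "piso (psub P {a}) C1"
        unfolding piso_def using refl[OF ab(1)]
        by (intro exI[of _ "\<lambda>_. 0"]) (auto simp: psub_def C1_def pcar_def ple_def bij_betw_def)
      \<comment> \<open>A one-element subset has no strict pairs, so every singleton is maximally
        ordered.\<close>
      show "nlt P T \<le> nlt P {a}" if T: "card T = card {a}" for T
      proof -
        from T obtain t where "T = {t}" by (auto simp: card_1_singleton_iff)
        then have none: "{(x, y). x \<in> T \<and> y \<in> T \<and> ple P x y \<and> x \<noteq> y} = {}" by auto
        show ?thesis unfolding nlt_def none by simp
      qed
    qed simp
    from sym1_reflection[OF this, of a] have "sym1 P C1 2 a b" using False by (simp add: s)
    then show ?thesis unfolding symrel_def by (rule r_into_rtranclp)
  qed
  show ?thesis
  proof (rule oquot_piso_C2)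
    show "symrel P C1 2 a b" if "a \<in> L" "b \<in> L" for a b
      using that carrier by (intro swap) simp_all
    show "symrel P C1 2 a b" if "a \<in> U" "b \<in> U" for a b
      using that carrier disjoint by (intro swap) auto
  qed
qed

end

section \<open>Coordinates and reflections of the polygon\<close>

lemma piso_of_bij_betw:
  assumes f: "bij_betw f I (pcar F)" and h: "bij_betw h I (pcar P)"
    and le: "\<And>i j. i \<in> I \<Longrightarrow> j \<in> I \<Longrightarrow> ple P (h i) (h j) \<longleftrightarrow> ple F (f i) (f j)"
  shows "piso P F"
proof -
  define k where "k = f \<circ> the_inv_into I h"
  have inj: "inj_on h I" and img: "h ` I = pcar P" using h unfolding bij_betw_def by blast+
  have k: "k (h i) = f i" if "i \<in> I" for i
    unfolding k_def using the_inv_into_f_f[OF inj that] by simp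
  have "bij_betw k (pcar P) (pcar F)"
    unfolding k_def using bij_betw_the_inv_into[OF h] f by (rule bij_betw_trans)
  moreover have "\<forall>x\<in>h ` I. \<forall>y\<in>h ` I. ple P x y \<longleftrightarrow> ple F (k x) (k y)"
    using le k by simp
  ultimately show ?thesis
    unfolding piso_def img by blast
qed

text \<open>The maximum of \<open>T\<close> has no successor in \<open>T\<close>. This is the edge
  bound for a union of paths, with edges recorded by their smaller end.\<close>

lemma card_consecutive_less:
  assumes "finite T" "T \<noteq> {}"
  shows "card {t \<in> T. Suc t \<in> T} < card T"
proof (rule psubset_card_mono[OF assms(1)])
  have "Suc (Max T) \<notin> T"
    using Max_ge[OF assms(1), of "Suc (Max T)"] by auto
  then show "{t \<in> T. Suc t \<in> T} \<subset> T"
    using Max_in[OF assms] by blast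
qed

lemma pcar_Gpos: "pcar (Gpos n) = {0..<2 * n}"
  unfolding Gpos_def pcar_def by simp

text \<open>A form invariant under even rotations and symmetric in the two directions. An even index
  is never \<open>2 * n - 1\<close>, so its successor does not wrap, and \<open>2 * n\<close> being
  even makes the oddness of \<open>j\<close> a consequence of adjacency.\<close>

lemma ple_Gpos_iff:
  assumes "i < 2 * n" "j < 2 * n"
  shows "ple (Gpos n) i j \<longleftrightarrow>
    i = j \<or> even i \<and> (j = Suc i mod (2 * n) \<or> i = Suc j mod (2 * n))"
proof -
  have parity: "even (Suc k mod (2 * n)) \<longleftrightarrow> odd k" for k
    by (simp add: dvd_mod_iff)
  have "even i \<Longrightarrow> Suc i mod (2 * n) = Suc i"
    using assms(1) by (metis Suc_lessI dvd_triv_left even_Suc mod_less)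
  then show ?thesis
    unfolding Gpos_def ple_def using parity[of i] parity[of j] by auto
qed

locale ngon_reflection =
  fixes n v :: nat
  assumes two_le: "2 \<le> n" and centre: "v < 2 * n"
begin

text \<open>The reflection fixes \<open>v\<close> and its antipode. In the coordinate \<open>t\<close> counting steps from \<open>v\<close>
  it is \<open>t \<mapsto> 2n - t\<close>.\<close>

definition around :: "nat \<Rightarrow> nat" where "around t = (v + t) mod (2 * n)"

definition reflect :: "nat \<Rightarrow> nat" where "reflect x = (2 * v + 2 * n - x) mod (2 * n)"

lemma around_cases:
  "t < 2 * n \<Longrightarrow> around t = (if v + t < 2 * n then v + t else v + t - 2 * n)"
  unfolding around_def using centre by (simp add: mod_if)

lemma around_less: "around t < 2 * n"
  unfolding around_def using two_le by simp

lemma around_eq_iff: "s < 2 * n \<Longrightarrow> t < 2 * n \<Longrightarrow> around s = around t \<longleftrightarrow> s = t"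
  using centre by (auto simp: around_cases)

lemma inj_on_around: "T \<subseteq> {0..<2 * n} \<Longrightarrow> inj_on around T"
  by (rule inj_onI) (metis around_eq_iff atLeastLessThan_iff subsetD)

lemma around_surj: "around ` {0..<2 * n} = {0..<2 * n}"
  by (rule endo_inj_surj) (auto simp: around_less inj_on_around)

lemma sides_disjoint: "around ` {1..<n} \<inter> around ` {n + 1..<2 * n} = {}"
proof -
  have "around ` {1..<n} \<inter> around ` {n + 1..<2 * n} = around ` ({1..<n} \<inter> {n + 1..<2 * n})"
    using inj_on_around[OF order_refl] by (rule inj_on_image_Int[symmetric]) auto
  also have "{1..<n} \<inter> {n + 1..<2 * n} = {}" by auto
  finally show ?thesis by simp
qed

lemma even_around: "even (around t) \<longleftrightarrow> even (v + t)"
  unfolding around_def by (simp add: dvd_mod_iff)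

text \<open>\<open>around\<close> commutes with the cyclic successor. The only wraparound involves
  coordinate 0, the centre, so the two sides of the reflection never meet it.\<close>

lemma around_Suc_eq_iff:
  assumes s: "s < 2 * n" and t: "t < 2 * n"
  shows "around t = Suc (around s) mod (2 * n) \<longleftrightarrow> t = s + 1 \<or> t = 0 \<and> s = 2 * n - 1"
proof -
  have "Suc (around s) mod (2 * n) = around (Suc s mod (2 * n))"
    unfolding around_def by (simp add: mod_Suc_eq mod_add_right_eq)
  then have "around t = Suc (around s) mod (2 * n) \<longleftrightarrow> t = Suc s mod (2 * n)"
    using around_eq_iff[OF t, of "Suc s mod (2 * n)"] two_le by simp
  also have "\<dots> \<longleftrightarrow> t = s + 1 \<or> t = 0 \<and> s = 2 * n - 1"
    using s t by (cases "Suc s = 2 * n") auto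
  finally show ?thesis .
qed

lemma ple_around_iff:
  assumes s: "s < 2 * n" and t: "t < 2 * n"
  shows "ple (Gpos n) (around s) (around t) \<longleftrightarrow>
    s = t \<or> even (v + s) \<and> (t = s + 1 \<or> s = t + 1 \<or> s = 0 \<and> t = 2 * n - 1 \<or> t = 0 \<and> s = 2 * n - 1)"
  unfolding ple_Gpos_iff[OF around_less around_less] around_eq_iff[OF s t] even_around
    around_Suc_eq_iff[OF s t] around_Suc_eq_iff[OF t s] by blast

text \<open>The separate case \<open>t = 0\<close> keeps the new coordinate below
  \<open>2 * n\<close>, the range on which \<open>around\<close> is injective.\<close>

lemma reflect_around:
  assumes "t < 2 * n"
  shows "reflect (around t) = around (if t = 0 then 0 else 2 * n - t)"
proof (cases "v + t < 2 * n")
  case True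
  \<comment> \<open>The summand \<open>2 * n\<close> in \<open>reflect\<close> prevents truncated
    subtraction; any surplus \<open>2 * n\<close> disappears in the final reduction.\<close>
  then have "2 * v + 2 * n - around t = v + (2 * n - t)"
    using assms around_cases[OF assms] by simp
  then show ?thesis unfolding reflect_def by (simp add: around_def)
next
  case False
  then have "2 * v + 2 * n - around t = v + (2 * n - t) + 2 * n"
    using assms around_cases[OF assms] centre by simp
  then show ?thesis unfolding reflect_def by (simp add: around_def)
qed

lemma is_aut_reflect: "is_aut (Gpos n) reflect"
proof -
  have coord: "\<exists>t<2 * n. x = around t" if "x \<in> pcar (Gpos n)" for x
    using that unfolding pcar_Gpos by (subst (asm) around_surj[symmetric]) auto
  have invol: "reflect (reflect x) = x" if "x \<in> pcar (Gpos n)" for x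
  proof -
    obtain t where t: "t < 2 * n" "x = around t" using coord[OF \<open>x \<in> pcar (Gpos n)\<close>] by blast
    have "(if t = 0 then 0 else 2 * n - t) < 2 * n" using t by simp
    from reflect_around[OF this] reflect_around[OF t(1)] t show ?thesis
      by (simp split: if_splits)
  qed
  have "bij_betw reflect (pcar (Gpos n)) (pcar (Gpos n))"
    by (rule bij_betw_byWitness[where f' = reflect])
       (use invol two_le in \<open>auto simp: reflect_def pcar_Gpos\<close>)
  moreover have "ple (Gpos n) x y \<longleftrightarrow> ple (Gpos n) (reflect x) (reflect y)"
    if xy: "x \<in> pcar (Gpos n)" "y \<in> pcar (Gpos n)" for x y
  proof -
    obtain s t where s: "s < 2 * n" "x = around s" and t: "t < 2 * n" "y = around t"
      using coord[OF xy(1)] coord[OF xy(2)] by blast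
    define flip where "flip t = (if t = 0 then 0 else 2 * n - t)" for t
    have lt: "flip s < 2 * n" "flip t < 2 * n" unfolding flip_def using s t by auto
    have parity: "even (v + flip s) \<longleftrightarrow> even (v + s)" unfolding flip_def using s by auto
    have inj: "flip s = flip t \<longleftrightarrow> s = t" unfolding flip_def using s t by auto
    \<comment> \<open>In coordinates the reflection reverses the cyclic successor. Using this for
      both orders of \<open>s\<close> and \<open>t\<close> gives invariance of adjacency.\<close>
    have succ: "flip t = flip s + 1 \<or> flip t = 0 \<and> flip s = 2 * n - 1 \<longleftrightarrow>
        s = t + 1 \<or> s = 0 \<and> t = 2 * n - 1" if "s < 2 * n" "t < 2 * n" for s t
    proof (cases "s = 0 \<or> t = 0")
      case True
      then show ?thesis unfolding flip_def using that by auto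
    next
      case False
      then have "2 * n - t = 2 * n - s + 1 \<longleftrightarrow> s = t + 1" using that by linarith
      then show ?thesis unfolding flip_def using False that by simp
    qed
    have "ple (Gpos n) (around (flip s)) (around (flip t)) \<longleftrightarrow> ple (Gpos n) (around s) (around t)"
      unfolding ple_around_iff[OF s(1) t(1)] ple_around_iff[OF lt] parity inj
      using succ[OF s(1) t(1)] succ[OF t(1) s(1)] by argo
    then show ?thesis
      unfolding s(2) t(2) reflect_around[OF s(1)] reflect_around[OF t(1)] flip_def by simp
  qed
  ultimately show ?thesis unfolding is_aut_def by blast
qed

text \<open>A fixed coordinate satisfies \<open>2 * t = 0\<close> modulo \<open>2 * n\<close>, which
  leaves only 0 and \<open>n\<close>.\<close>

lemma Sig_reflect: "Sig (Gpos n) reflect = around ` {1..<n} \<union> around ` {n + 1..<2 * n}"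
proof -
  have "reflect (around t) \<noteq> around t \<longleftrightarrow> t \<noteq> 0 \<and> t \<noteq> n" if "t < 2 * n" for t
    unfolding reflect_around[OF that] using that by (subst around_eq_iff) auto
  then have "Sig (Gpos n) reflect = around ` {t \<in> {0..<2 * n}. t \<noteq> 0 \<and> t \<noteq> n}"
    unfolding Sig_def pcar_Gpos by (subst around_surj[symmetric]) auto
  also have "{t \<in> {0..<2 * n}. t \<noteq> 0 \<and> t \<noteq> n} = {1..<n} \<union> {n + 1..<2 * n}" by auto
  finally show ?thesis by (simp only: image_Un)
qed

text \<open>Coordinate 0 is excluded, so strict pairs come only from consecutive coordinates, and
  each such edge has exactly one orientation.\<close>

lemma nlt_around:
  assumes T: "T \<subseteq> {1..<2 * n}"
  shows "nlt (Gpos n) (around ` T) = card {t \<in> T. Suc t \<in> T}"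
proof -
  \<comment> \<open>Orients the edge from \<open>t\<close> to \<open>Suc t\<close> with its minimal
    end first.\<close>
  define p where "p t = (if even (v + t) then (around t, around (Suc t)) else (around (Suc t), around t))" for t
  have lt: "t < 2 * n" "t \<noteq> 0" if "t \<in> T" for t using that T by auto
  have "{(a, b). a \<in> around ` T \<and> b \<in> around ` T \<and> ple (Gpos n) a b \<and> a \<noteq> b} = p ` {t \<in> T. Suc t \<in> T}"
  proof (intro equalityI subsetI)
    fix e assume "e \<in> {(a, b). a \<in> around ` T \<and> b \<in> around ` T \<and> ple (Gpos n) a b \<and> a \<noteq> b}"
    then obtain s t where st: "s \<in> T" "t \<in> T" "e = (around s, around t)"
      "ple (Gpos n) (around s) (around t)" "s \<noteq> t" by auto
    then have "even (v + s) \<and> (t = Suc s \<or> s = Suc t)"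
      using ple_around_iff[OF lt(1)[OF st(1)] lt(1)[OF st(2)]] lt(2) by auto
    then consider "even (v + s)" "t = Suc s" | "odd (v + t)" "s = Suc t" by auto
    then show "e \<in> p ` {t \<in> T. Suc t \<in> T}"
    proof cases
      case 1
      then show ?thesis using st by (intro image_eqI[of _ _ s]) (auto simp: p_def)
    next
      case 2
      then show ?thesis using st by (intro image_eqI[of _ _ t]) (auto simp: p_def)
    qed
  next
    fix e assume "e \<in> p ` {t \<in> T. Suc t \<in> T}"
    then obtain t where t: "t \<in> T" "Suc t \<in> T" "e = p t" by blast
    have "around t \<noteq> around (Suc t)" using around_eq_iff[OF lt(1)[OF t(1)] lt(1)[OF t(2)]] by simp
    moreover have "even (v + t) \<Longrightarrow> ple (Gpos n) (around t) (around (Suc t))"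
      using ple_around_iff[OF lt(1)[OF t(1)] lt(1)[OF t(2)]] by simp
    moreover have "odd (v + t) \<Longrightarrow> ple (Gpos n) (around (Suc t)) (around t)"
      using ple_around_iff[OF lt(1)[OF t(2)] lt(1)[OF t(1)]] by simp
    ultimately show "e \<in> {(a, b). a \<in> around ` T \<and> b \<in> around ` T \<and> ple (Gpos n) a b \<and> a \<noteq> b}"
      using t by (cases "even (v + t)") (auto simp: p_def)
  qed
  moreover have "inj_on p {t \<in> T. Suc t \<in> T}"
  proof (rule inj_onI)
    fix s t assume s: "s \<in> {t \<in> T. Suc t \<in> T}" and t: "t \<in> {t \<in> T. Suc t \<in> T}" and eq: "p s = p t"
    \<comment> \<open>Forgetting the orientation leaves the unordered edge, which determines its
      smaller coordinate.\<close>
    have "{around s, around (Suc s)} = {around t, around (Suc t)}"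
      using eq by (auto simp: p_def split: if_splits)
    then have "around ` {s, Suc s} = around ` {t, Suc t}" by simp
    moreover have "{s, Suc s} \<subseteq> {0..<2 * n}" "{t, Suc t} \<subseteq> {0..<2 * n}"
      using s t lt(1) by auto
    ultimately have "{s, Suc s} = {t, Suc t}"
      using inj_on_image_eq_iff[OF inj_on_around[OF order_refl]] by metis
    then show "s = t" by (auto simp: doubleton_eq_iff)
  qed
  ultimately show ?thesis
    unfolding nlt_def by (simp add: card_image)
qed

text \<open>The first fence position sits at coordinate 1, next to the centre. It is minimal exactly
  when \<open>v\<close> is odd, which explains the fence type.\<close>

lemma generator_reflect:
  assumes f: "bij_betw f {0..<n - 1} (pcar F)"
    and le: "\<And>i j. i < n - 1 \<Longrightarrow> j < n - 1 \<Longrightarrow> ple F (f i) (f j) \<longleftrightarrow> fence_rel (odd v) i j"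
  shows "generator (Gpos n) F 2 reflect
    (\<lambda>i. if i = 0 then around ` {1..<n} else around ` {n + 1..<2 * n})"
proof (rule generator_reflection[OF is_aut_reflect Sig_reflect])
  have img: "reflect ` around ` T = around ` (\<lambda>t. 2 * n - t) ` T" if "T \<subseteq> {1..<2 * n}" for T
    unfolding image_image using that by (intro image_cong HOL.refl) (auto simp: reflect_around)
  have flip: "(\<lambda>t. 2 * n - t) ` {1..<n} = {n + 1..<2 * n}"
  proof (intro equalityI subsetI)
    fix t assume "t \<in> {n + 1..<2 * n}"
    then show "t \<in> (\<lambda>t. 2 * n - t) ` {1..<n}" by (intro image_eqI[of _ _ "2 * n - t"]) auto
  qed auto
  have flip': "(\<lambda>t. 2 * n - t) ` {n + 1..<2 * n} = {1..<n}"
  proof (intro equalityI subsetI)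
    fix t assume "t \<in> {1..<n}"
    then show "t \<in> (\<lambda>t. 2 * n - t) ` {n + 1..<2 * n}" by (intro image_eqI[of _ _ "2 * n - t"]) auto
  qed auto
  show "reflect ` around ` {1..<n} = around ` {n + 1..<2 * n}"
    using img[of "{1..<n}"] unfolding flip by simp
  show "reflect ` around ` {n + 1..<2 * n} = around ` {1..<n}"
    using img[of "{n + 1..<2 * n}"] unfolding flip' by simp
  show "around ` {1..<n} \<inter> around ` {n + 1..<2 * n} = {}"
    by (rule sides_disjoint)
  show "finite (around ` {1..<n})" by simp
  show "\<not> ple (Gpos n) a b \<and> \<not> ple (Gpos n) b a"
    if ab: "a \<in> around ` {1..<n}" "b \<in> around ` {n + 1..<2 * n}" for a b
  proof -
    \<comment> \<open>Coordinates on opposite sides of \<open>n\<close> differ by at least two, and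
      neither side contains 0.\<close>
    from ab obtain s t where "s \<in> {1..<n}" "t \<in> {n + 1..<2 * n}" "a = around s" "b = around t" by blast
    then show ?thesis using ple_around_iff[of s t] ple_around_iff[of t s] by auto
  qed
  show "piso (psub (Gpos n) (around ` {1..<n})) F"
  proof (rule piso_of_bij_betw[OF f, where h = "\<lambda>i. around (Suc i)"])
    have "Suc ` {0..<n - 1} = {1..<n}"
      using two_le by (simp add: image_Suc_atLeastLessThan)
    then have "(around \<circ> Suc) ` {0..<n - 1} = around ` {1..<n}"
      by (simp only: image_comp[symmetric])
    moreover have "inj_on (around \<circ> Suc) {0..<n - 1}"
      by (intro comp_inj_on inj_on_around) auto
    ultimately show "bij_betw (\<lambda>i. around (Suc i)) {0..<n - 1} (pcar (psub (Gpos n) (around ` {1..<n})))"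
      unfolding bij_betw_def psub_def pcar_def comp_def by simp
    show "ple (psub (Gpos n) (around ` {1..<n})) (around (Suc i)) (around (Suc j)) \<longleftrightarrow> ple F (f i) (f j)"
      if "i \<in> {0..<n - 1}" "j \<in> {0..<n - 1}" for i j
    proof -
      have "ple (psub (Gpos n) (around ` {1..<n})) = ple (Gpos n)"
        unfolding psub_def ple_def by simp
      then show ?thesis
        using that le[of i j] ple_around_iff[of "Suc i" "Suc j"] unfolding fence_rel_def by auto
    qed
  qed
  show "nlt (Gpos n) T \<le> nlt (Gpos n) (around ` {1..<n})"
    if T: "T \<subseteq> Sig (Gpos n) reflect" "card T = card (around ` {1..<n})" for T
  proof -
    have "T \<subseteq> around ` ({1..<n} \<union> {n + 1..<2 * n})"
      using T(1) unfolding Sig_reflect by (simp only: image_Un)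
    then obtain T' where T': "T' \<subseteq> {1..<n} \<union> {n + 1..<2 * n}" "T = around ` T'"
      by (meson subset_image_iff)
    then have sub: "T' \<subseteq> {1..<2 * n}" by auto
    have "finite T'" using sub by (rule finite_subset) simp
    have inj: "inj_on around T'" "inj_on around {1..<n}"
      using sub by (auto intro!: inj_on_around)
    then have "card T' = n - 1"
      using T(2) T'(2) by (simp add: card_image)
    \<comment> \<open>\<open>T'\<close> is nonempty because \<open>n - 1\<close> is at least 1. The
      resulting bound \<open>n - 2\<close> is attained by the interval
      \<open>{1..<n}\<close>.\<close>
    then have "card {t \<in> T'. Suc t \<in> T'} < n - 1"
      using card_consecutive_less[OF \<open>finite T'\<close>] two_le by force
    then have "nlt (Gpos n) T < n - 1" using nlt_around[OF sub] T'(2) by simp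
    moreover have "{t \<in> {1..<n}. Suc t \<in> {1..<n}} = {1..<n - 1}" by auto
    then have "nlt (Gpos n) (around ` {1..<n}) = n - 2"
      using nlt_around[of "{1..<n}"] by simp
    ultimately show ?thesis by simp
  qed
qed

end

section \<open>Collapsing the layers of the polygon\<close>

lemma symrel_Gpos:
  assumes n: "2 \<le> n" and f: "bij_betw f {0..<n - 1} (pcar F)"
    and le: "\<And>i j. i < n - 1 \<Longrightarrow> j < n - 1 \<Longrightarrow> ple F (f i) (f j) \<longleftrightarrow> fence_rel lower i j"
    and a: "a < 2 * n" "even a \<longleftrightarrow> lower" and b: "b < 2 * n" "even b \<longleftrightarrow> lower"
  shows "symrel (Gpos n) F 2 a b"
proof -
  \<comment> \<open>The reflection about \<open>x + 1\<close> exchanges its neighbours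
    \<open>x + 2\<close> and \<open>x\<close>. The parity of this centre yields a fence of type
    \<open>lower\<close>.\<close>
  have step: "sym1 (Gpos n) F 2 (x + 2) x" if x: "x + 2 < 2 * n" "even x \<longleftrightarrow> lower" for x
  proof -
    interpret ngon_reflection n "x + 1" by unfold_locales (use n x in auto)
    have "odd (x + 1) = lower" using x by simp
    then have "generator (Gpos n) F 2 reflect
        (\<lambda>i. if i = 0 then around ` {1..<n} else around ` {n + 1..<2 * n})"
      by (intro generator_reflect[OF f]) (simp add: le)
    then have "sym1 (Gpos n) F 2 (around 1) (reflect (around 1))"
      by (rule sym1_reflection[OF _ sides_disjoint]) (use n in auto)
    moreover have "reflect (around 1) = around (2 * n - 1)" using reflect_around[of 1] n by simp
    moreover have "around 1 = x + 2" "around (2 * n - 1) = x"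
      using around_cases[of 1] around_cases[of "2 * n - 1"] x n by auto
    ultimately show ?thesis by simp
  qed
  \<comment> \<open>Descent in steps of two to the least index of the layer, which then links any
    two members.\<close>
  have base: "symrel (Gpos n) F 2 x (if lower then 0 else 1)"
    if "x < 2 * n" "even x \<longleftrightarrow> lower" for x
    using that
  proof (induction x rule: less_induct)
    case (less x)
    show ?case
    proof (cases "x < 2")
      case True
      then have "x = (if lower then 0 else 1)" using less.prems by (auto simp: less_2_cases_iff)
      then show ?thesis by (simp add: symrel_refl)
    next
      case False
      then obtain y where y: "x = y + 2" by (metis add.commute le_Suc_ex linorder_not_less)
      have "sym1 (Gpos n) F 2 x y" using step[of y] less.prems y by simp
      moreover have "symrel (Gpos n) F 2 y (if lower then 0 else 1)"
        using less.IH[of y] less.prems y by simp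
      ultimately show ?thesis
        unfolding symrel_def by (rule converse_rtranclp_into_rtranclp)
    qed
  qed
  show ?thesis
    using symrel_trans[OF base[OF a] symrel_sym[OF base[OF b]]] .
qed

lemma two_layer_Gpos:
  assumes "2 \<le> n"
  shows "two_layer (Gpos n) {i. i < 2 * n \<and> even i} {i. i < 2 * n \<and> odd i}"
proof
  show "pcar (Gpos n) = {i. i < 2 * n \<and> even i} \<union> {i. i < 2 * n \<and> odd i}"
    unfolding pcar_Gpos by auto
  show "{i. i < 2 * n \<and> even i} \<noteq> {}" using assms by (auto intro!: exI[of _ 0])
  show "\<exists>j\<in>{i. i < 2 * n \<and> odd i}. ple (Gpos n) i j" if "i \<in> {i. i < 2 * n \<and> even i}" for i
  proof
    have "i + 1 \<noteq> 2 * n" using that by (metis (mono_tags) dvd_triv_left even_plus_one_iff mem_Collect_eq)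
    then show "i + 1 \<in> {i. i < 2 * n \<and> odd i}" using that by auto
    then show "ple (Gpos n) i (i + 1)" using that by (subst ple_Gpos_iff) auto
  qed
  show "\<exists>i\<in>{i. i < 2 * n \<and> even i}. ple (Gpos n) i j" if "j \<in> {i. i < 2 * n \<and> odd i}" for j
  proof
    have "j \<noteq> 0" using that by (intro notI) simp
    then show "j - 1 \<in> {i. i < 2 * n \<and> even i}" using that by auto
    then show "ple (Gpos n) (j - 1) j" using that \<open>j \<noteq> 0\<close> by (subst ple_Gpos_iff) auto
  qed
qed (auto simp: Gpos_def pcar_def ple_def)

text \<open>For even \<open>m\<close> the last position \<open>m - 1\<close> is odd, so reversal
  preserves adjacency but flips parity, turning lower fences into upper ones.\<close>

lemma fence_rel_reverse:
  assumes "even m" "i < m" "j < m"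
  shows "fence_rel lower (m - 1 - i) (m - 1 - j) \<longleftrightarrow> fence_rel (\<not> lower) i j"
proof -
  have "even (m - 1 - i) \<longleftrightarrow> odd i" using assms by auto
  moreover have "m - 1 - i = m - 1 - j \<longleftrightarrow> i = j"
    "m - 1 - j = m - 1 - i + 1 \<longleftrightarrow> i = j + 1" "m - 1 - i = m - 1 - j + 1 \<longleftrightarrow> j = i + 1"
    using assms by auto
  ultimately show ?thesis unfolding fence_rel_def by auto
qed

theorem mainTheorem9:
  fixes n :: nat and F :: "'b pos"
  assumes "2 \<le> n" and "is_fence (n - 1) F"
  shows "(odd n \<longrightarrow> piso (oquot (Gpos n) F) C2) \<and>
         (even n \<longrightarrow> piso (oquot (oquot (Gpos n) F) C1) C2)"
proof -
  let ?L = "{i. i < 2 * n \<and> even i}" and ?U = "{i. i < 2 * n \<and> odd i}"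
  interpret G: two_layer "Gpos n" ?L ?U by (rule two_layer_Gpos[OF assms(1)])
  from assms(2) obtain lower f where f: "bij_betw f {0..<n - 1} (pcar F)"
    and le: "\<And>i j. i < n - 1 \<Longrightarrow> j < n - 1 \<Longrightarrow> ple F (f i) (f j) \<longleftrightarrow> fence_rel lower i j"
    unfolding is_fence_def by blast
  have same: "symrel (Gpos n) F 2 a b"
    if "a < 2 * n" "even a \<longleftrightarrow> lower" "b < 2 * n" "even b \<longleftrightarrow> lower" for a b
    by (rule symrel_Gpos[OF assms(1) f le that])
  show ?thesis
  proof (intro conjI impI)
    assume "odd n"
    \<comment> \<open>Since \<open>n - 1\<close> is even, reversing the enumeration presents
      \<open>F\<close> as a fence of the other type, which makes the other layer collapse
      too.\<close>
    let ?r = "\<lambda>i. n - 1 - 1 - i"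
    have "bij_betw ?r {0..<n - 1} {0..<n - 1}"
      by (rule bij_betw_byWitness[where f' = ?r]) auto
    then have f': "bij_betw (f \<circ> ?r) {0..<n - 1} (pcar F)" using f by (rule bij_betw_trans)
    have le': "ple F ((f \<circ> ?r) i) ((f \<circ> ?r) j) \<longleftrightarrow> fence_rel (\<not> lower) i j"
      if "i < n - 1" "j < n - 1" for i j
      using le[of "?r i" "?r j"] fence_rel_reverse[of "n - 1" i j lower] that \<open>odd n\<close> by simp
    have other: "symrel (Gpos n) F 2 a b"
      if "a < 2 * n" "even a \<longleftrightarrow> \<not> lower" "b < 2 * n" "even b \<longleftrightarrow> \<not> lower" for a b
      by (rule symrel_Gpos[OF assms(1) f' le' that])
    show "piso (oquot (Gpos n) F) C2"
      by (rule G.oquot_piso_C2) (use same other in \<open>cases lower; simp\<close>)+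
  next
    \<comment> \<open>Only the layer containing the ends of the fence is known to collapse to a single class;
      since every class is comparable to some class of that layer, the quotient is complete bipartite.\<close>
    interpret Q: two_layer "oquot (Gpos n) F" "G.sym_class F ` ?L" "G.sym_class F ` ?U"
      by (rule G.two_layer_oquot)
    show "piso (oquot (oquot (Gpos n) F) C1) C2"
    proof (rule Q.oquot_C1_piso_C2)
      fix X Y assume X: "X \<in> G.sym_class F ` ?L" and Y: "Y \<in> G.sym_class F ` ?U"
      show "ple (oquot (Gpos n) F) X Y"
      proof (cases lower)
        case True
        obtain Z where Z: "Z \<in> G.sym_class F ` ?L" "ple (oquot (Gpos n) F) Z Y"
          using Q.below[OF Y] by blast
        have "Z = X" using X Z(1) True by (auto intro!: G.sym_class_eq same)
        then show ?thesis using Z(2) by simp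
      next
        case False
        obtain Z where Z: "Z \<in> G.sym_class F ` ?U" "ple (oquot (Gpos n) F) X Z"
          using Q.above[OF X] by blast
        have "Z = Y" using Y Z(1) False by (auto intro!: G.sym_class_eq same)
        then show ?thesis using Z(2) by simp
      qed
    qed
  qed
qed

end
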